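(* The discrete massless Dirac-Kähler equation $(d^c-\delta^c)\Omega=0$ for inhomogeneous forms $\Omega\in K(4)$ is invariant under the transformation $$\Omega\to\Omega+d^c\Phi-\delta^c\Phi,$$ where $\Phi\in K(4)$ is an inhomogeneous form satisfying $\Delta^c\Phi=0$. That is, for every such $\Phi$ and every $\Omega\in K(4)$, $(d^c-\delta^c)\Omega=0$ if and only if $(d^c-\delta^c)(\Omega+d^c\Phi-\delta^c\Phi)=0$.
   Context: Chains. Let $C=C^0\oplus C^1$, where $C^0$ is the real vector space with basis $x_\kappa$ ($\kappa\in\mathbb Z$) and $C^1$ the real vector space with basis $e_\kappa$ ($\kappa\in\mathbb Z$); put $\tau\kappa=\kappa+1$, $\partial x_\kappa=0$, $\partial e_\kappa=x_{\tau\kappa}-x_\kappa$. Let $C(4)=C\otimes C\otimes C\otimes C$, with basis elements $s_k=s_{k_0}\otimes s_{k_1}\otimes s_{k_2}\otimes s_{k_3}$, $k=(k_0,k_1,k_2,k_3)\in\mathbb Z^4$, each $s_{k_i}$ being $x_{k_i}$ or $e_{k_i}$; the dimension of $s_k$ is the number of factors of type $e$. The boundary is extended by $\partial(a\otimes b)=\partial a\otimes b+(-1)^{\dim a}a\otimes\partial b$ and linearity. Cochains (discrete forms). $K(4)=K\otimes K\otimes K\otimes K$ is the dual complex of real cochains, with basis elements $s^k=s^{k_0}\otimes s^{k_1}\otimes s^{k_2}\otimes s^{k_3}$, each $s^{k_i}$ being $x^{k_i}$ or $e^{k_i}$. Forms are (possibly infinite) formal real linear combinations of basis elements. The pairing is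 $\langle \varepsilon_k,s^k\rangle=1$ if $\varepsilon_k=s_k$ is the corresponding basis chain and $0$ otherwise, extended linearly. $K^r(4)$ is the space of forms of degree $r$, $K(4)=\bigoplus_{r=0}^4K^r(4)$. The coboundary $d^c:K^r(4)\to K^{r+1}(4)$ is defined by $\langle\partial a,\omega\rangle=\langle a,d^c\omega\rangle$ for all $(r+1)$-chains $a$; $d^c\omega=0$ for $\omega\in K^4(4)$. Cup product. On $K$: $x^\kappa\cup x^\kappa=x^\kappa$, $e^\kappa\cup x^{\tau\kappa}=e^\kappa$, $x^\kappa\cup e^\kappa=e^\kappa$, and all other products of basis elements are $0$. Inductively, for basis elements $s_{(p)},s_{(q)}$ of the $n$-fold tensor product of $K$ (of degrees $p,q$) and basis elements $s^\kappa,s^\mu$ of $K$, $(s_{(p)}\otimes s^\kappa)\cup(s_{(q)}\otimes s^\mu)=Q(\kappa,q)\,(s_{(p)}\cup s_{(q)})\otimes(s^\kappa\cup s^\mu)$, where $Q(\kappa,q)=-1$ if both $s^\kappa$ and $s_{(q)}$ have odd degree and $Q(\kappa,q)=+1$ otherwise. Extend linearly. Star operator (Lorentz signature). $\ast:K^r(4)\to K^{4-r}(4)$ is the linear bijection sending a basis element $s^k$ to the unique element of the form $\pm$(basis element) with $s^k\cup\ast s^k=Q(k_0)e^k$, where $e^k=e^{k_0}\otimes e^{k_1}\otimes e^{k_2}\otimes e^{k_3}$, $Q(k_0)=+1$ if $s^{k_0}=x^{k_0}$ and $Q(k_0)=-1$ if $s^{k_0}=e^{k_0}$ (so, up to sign,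 $\ast$ replaces each factor $x^{k_i}$ by $e^{k_i}$ and each factor $e^{k_i}$ by $x^{\tau k_i}$). Codifferential and Laplacian. $\delta^c:K^{r+1}(4)\to K^r(4)$, $\delta^c\psi=(-1)^{r+1}\ast^{-1}d^c\ast\psi$ for $\psi\in K^{r+1}(4)$, $r=0,1,2,3$; $\delta^c\omega=0$ for $\omega\in K^0(4)$. $\Delta^c=-(d^c\delta^c+\delta^cd^c)$. All operators act on inhomogeneous forms (sums of forms of different degrees) by linearity. *)

theory Defs
  imports Complex_Main "HOL-Library.Poly_Mapping" "HOL-Library.Groups_Big_Fun"
    "HOL-Library.Function_Algebras"
begin

section \<open>Basis elements\<close>

text \<open>
  A basis element of \<open>C\<close> is \<open>x\<^sub>\<kappa>\<close> (\<open>X \<kappa>\<close>) or \<open>e\<^sub>\<kappa>\<close> (\<open>E \<kappa>\<close>); the same type indexes the dual basis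
  of \<open>K\<close>.  A basis of the tensor product of two spaces with bases \<open>'a\<close> and \<open>'b\<close> is \<open>'a \<times> 'b\<close>.
  The tensor powers are bracketed to the left, which is the bracketing on which the inductive
  definition of the cup product relies, so \<open>(((a, b), c), d)\<close> is the basis element
  \<open>a \<otimes> b \<otimes> c \<otimes> d\<close>, and \<open>a\<close> is the factor with index \<open>0\<close>.
\<close>

datatype cell = X int | E int

type_synonym cell2 = "cell \<times> cell"
type_synonym cell3 = "cell2 \<times> cell"
type_synonym cell4 = "cell3 \<times> cell"

abbreviation \<tau> :: "int \<Rightarrow> int" where "\<tau> \<kappa> \<equiv> \<kappa> + 1"

fun deg1 :: "cell \<Rightarrow> nat" where
  "deg1 (X \<kappa>) = 0"
| "deg1 (E \<kappa>) = 1"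

definition deg_tensor :: "('a \<Rightarrow> nat) \<Rightarrow> ('b \<Rightarrow> nat) \<Rightarrow> 'a \<times> 'b \<Rightarrow> nat" where
  "deg_tensor dA dB = (\<lambda>(a, b). dA a + dB b)"

definition deg2 :: "cell2 \<Rightarrow> nat" where "deg2 = deg_tensor deg1 deg1"
definition deg3 :: "cell3 \<Rightarrow> nat" where "deg3 = deg_tensor deg2 deg1"
definition deg4 :: "cell4 \<Rightarrow> nat" where "deg4 = deg_tensor deg3 deg1"


section \<open>Chains and boundary\<close>

text \<open>Chains are finite linear combinations, that is, elements of \<open>'a \<Rightarrow>\<^sub>0 real\<close>.\<close>

definition cbasis :: "'a \<Rightarrow> 'a \<Rightarrow>\<^sub>0 real" where
  "cbasis s = Poly_Mapping.single s 1"

definition cscale :: "real \<Rightarrow> ('a \<Rightarrow>\<^sub>0 real) \<Rightarrow> 'a \<Rightarrow>\<^sub>0 real" where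
  "cscale r a = Poly_Mapping.map ((*) r) a"

definition clinear_ext :: "('a \<Rightarrow> 'b \<Rightarrow>\<^sub>0 real) \<Rightarrow> ('a \<Rightarrow>\<^sub>0 real) \<Rightarrow> 'b \<Rightarrow>\<^sub>0 real" where
  "clinear_ext f a = (\<Sum>s\<in>Poly_Mapping.keys a. cscale (Poly_Mapping.lookup a s) (f s))"

definition ctensor :: "('a \<Rightarrow>\<^sub>0 real) \<Rightarrow> ('b \<Rightarrow>\<^sub>0 real) \<Rightarrow> 'a \<times> 'b \<Rightarrow>\<^sub>0 real" where
  "ctensor a b = clinear_ext (\<lambda>s. clinear_ext (\<lambda>t. cbasis (s, t)) b) a"

text \<open>Boundaries are first given on basis elements.\<close>

fun bdry1 :: "cell \<Rightarrow> cell \<Rightarrow>\<^sub>0 real" where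
  "bdry1 (X \<kappa>) = 0"
| "bdry1 (E \<kappa>) = cbasis (X (\<tau> \<kappa>)) - cbasis (X \<kappa>)"

definition bdry_tensor ::
    "('a \<Rightarrow> nat) \<Rightarrow> ('a \<Rightarrow> 'a \<Rightarrow>\<^sub>0 real) \<Rightarrow> ('b \<Rightarrow> 'b \<Rightarrow>\<^sub>0 real) \<Rightarrow> 'a \<times> 'b \<Rightarrow> 'a \<times> 'b \<Rightarrow>\<^sub>0 real" where
  "bdry_tensor dA bA bB = (\<lambda>(a, b).
     ctensor (bA a) (cbasis b) + cscale ((-1) ^ dA a) (ctensor (cbasis a) (bB b)))"

definition bdry2 :: "cell2 \<Rightarrow> cell2 \<Rightarrow>\<^sub>0 real" where "bdry2 = bdry_tensor deg1 bdry1 bdry1"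
definition bdry3 :: "cell3 \<Rightarrow> cell3 \<Rightarrow>\<^sub>0 real" where "bdry3 = bdry_tensor deg2 bdry2 bdry1"
definition bdry4 :: "cell4 \<Rightarrow> cell4 \<Rightarrow>\<^sub>0 real" where "bdry4 = bdry_tensor deg3 bdry3 bdry1"

definition bdry :: "(cell4 \<Rightarrow>\<^sub>0 real) \<Rightarrow> cell4 \<Rightarrow>\<^sub>0 real" where
  "bdry = clinear_ext bdry4"


section \<open>Forms and coboundary\<close>

text \<open>
  A form is a possibly infinite formal linear combination of basis elements, that is, an arbitrary
  function; vector space operations are pointwise.  The whole type is \<open>K(4)\<close>, so its elements are
  inhomogeneous forms.
\<close>

type_synonym form = "cell4 \<Rightarrow> real"

definition fbasis :: "'a \<Rightarrow> 'a \<Rightarrow> real" where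
  "fbasis s = (\<lambda>t. if t = s then 1 else 0)"

definition fscale :: "real \<Rightarrow> ('a \<Rightarrow> real) \<Rightarrow> 'a \<Rightarrow> real" where
  "fscale r \<omega> = (\<lambda>s. r * \<omega> s)"

definition homogeneous :: "nat \<Rightarrow> form set" where
  "homogeneous r = {\<omega>. \<forall>s. \<omega> s \<noteq> 0 \<longrightarrow> deg4 s = r}"

definition hpart :: "nat \<Rightarrow> form \<Rightarrow> form" where
  "hpart r \<omega> = (\<lambda>s. if deg4 s = r then \<omega> s else 0)"

definition pairing :: "('a \<Rightarrow>\<^sub>0 real) \<Rightarrow> ('a \<Rightarrow> real) \<Rightarrow> real" where
  "pairing a \<omega> = (\<Sum>s\<in>Poly_Mapping.keys a. Poly_Mapping.lookup a s * \<omega> s)"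

text \<open>
  Adjointness against all chains amounts to the degreewise adjointness, as \<open>bdry\<close> lowers the
  dimension by one: see \<open>dc_homogeneous\<close> and \<open>dc_top\<close> below.
\<close>

definition dc :: "form \<Rightarrow> form" where
  "dc \<omega> = (THE \<eta>. \<forall>a. pairing (bdry a) \<omega> = pairing a \<eta>)"


section \<open>Cup product\<close>

text \<open>Cup products are first given on basis elements.\<close>

fun cup1 :: "cell \<Rightarrow> cell \<Rightarrow> cell \<Rightarrow> real" where
  "cup1 (X \<kappa>) (X \<mu>) = (if \<mu> = \<kappa> then fbasis (X \<kappa>) else 0)"
| "cup1 (E \<kappa>) (X \<mu>) = (if \<mu> = \<tau> \<kappa> then fbasis (E \<kappa>) else 0)"
| "cup1 (X \<kappa>) (E \<mu>) = (if \<mu> = \<kappa> then fbasis (E \<kappa>) else 0)"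
| "cup1 (E \<kappa>) (E \<mu>) = 0"

definition ftensor :: "('a \<Rightarrow> real) \<Rightarrow> ('b \<Rightarrow> real) \<Rightarrow> 'a \<times> 'b \<Rightarrow> real" where
  "ftensor \<omega> \<eta> = (\<lambda>(s, t). \<omega> s * \<eta> t)"

definition Qcup :: "cell \<Rightarrow> nat \<Rightarrow> real" where
  "Qcup s q = (if odd (deg1 s) \<and> odd q then -1 else 1)"

definition cup_tensor ::
    "('a \<Rightarrow> nat) \<Rightarrow> ('a \<Rightarrow> 'a \<Rightarrow> 'a \<Rightarrow> real) \<Rightarrow> 'a \<times> cell \<Rightarrow> 'a \<times> cell \<Rightarrow> 'a \<times> cell \<Rightarrow> real" where
  "cup_tensor dA cA = (\<lambda>(p, s) (q, t). fscale (Qcup s (dA q)) (ftensor (cA p q) (cup1 s t)))"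

definition cup2 :: "cell2 \<Rightarrow> cell2 \<Rightarrow> cell2 \<Rightarrow> real" where "cup2 = cup_tensor deg1 cup1"
definition cup3 :: "cell3 \<Rightarrow> cell3 \<Rightarrow> cell3 \<Rightarrow> real" where "cup3 = cup_tensor deg2 cup2"
definition cup4 :: "cell4 \<Rightarrow> cell4 \<Rightarrow> form" where "cup4 = cup_tensor deg3 cup3"

text \<open>For each \<open>u\<close> only finitely many summands are nonzero, so this is total on infinite forms.\<close>

definition cup :: "form \<Rightarrow> form \<Rightarrow> form" where
  "cup \<omega> \<eta> = (\<lambda>u. Sum_any (\<lambda>(s, t). \<omega> s * \<eta> t * cup4 s t u))"


section \<open>Star, codifferential, Laplacian\<close>

fun top1 :: "cell \<Rightarrow> cell" where
  "top1 (X \<kappa>) = E \<kappa>"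
| "top1 (E \<kappa>) = E \<kappa>"

definition top4 :: "cell4 \<Rightarrow> cell4" where
  "top4 = (\<lambda>(((a, b), c), d). (((top1 a, top1 b), top1 c), top1 d))"

definition Qlorentz :: "cell4 \<Rightarrow> real" where
  "Qlorentz = (\<lambda>(((a, b), c), d). case a of X \<kappa> \<Rightarrow> 1 | E \<kappa> \<Rightarrow> -1)"

definition star_basis :: "cell4 \<Rightarrow> form" where
  "star_basis s = (THE \<phi>. (\<exists>t. \<phi> = fbasis t \<or> \<phi> = - fbasis t) \<and>
                          cup (fbasis s) \<phi> = fscale (Qlorentz s) (fbasis (top4 s)))"

text \<open>Only one summand is nonzero: see \<open>star_apply\<close> below.\<close>

definition star :: "form \<Rightarrow> form" where
  "star \<omega> = (\<lambda>t. Sum_any (\<lambda>s. \<omega> s * star_basis s t))"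

text \<open>
  The codifferential in degree \<open>r\<close> carries the sign \<open>(-1) ^ r\<close> (it is the case \<open>\<psi> \<in> K\<^sup>r\<close> with
  \<open>r \<ge> 1\<close>); it vanishes in degree \<open>0\<close>.
\<close>

definition codiff :: "form \<Rightarrow> form" where
  "codiff \<omega> = (\<Sum>r = 1..4. fscale ((-1) ^ r) (inv star (dc (star (hpart r \<omega>)))))"

definition laplacian :: "form \<Rightarrow> form" where
  "laplacian \<omega> = - (dc (codiff \<omega>) + codiff (dc \<omega>))"


section \<open>The definite descriptions are well defined\<close>

lemma pairing_superset:
  assumes "finite S" "Poly_Mapping.keys a \<subseteq> S"
  shows "pairing a \<omega> = (\<Sum>s\<in>S. Poly_Mapping.lookup a s * \<omega> s)"
  unfolding pairing_def using assms
  by (intro sum.mono_neutral_left) (auto simp: in_keys_iff)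

lemma pairing_add: "pairing (a + b) \<omega> = pairing a \<omega> + pairing b \<omega>"
proof -
  let ?S = "Poly_Mapping.keys a \<union> Poly_Mapping.keys b"
  have "Poly_Mapping.keys (a + b) \<subseteq> ?S" by (rule Poly_Mapping.keys_add)
  then show ?thesis
    by (simp add: pairing_superset[of ?S] lookup_add algebra_simps sum.distrib)
qed

lemma lookup_cscale [simp]: "Poly_Mapping.lookup (cscale r a) s = r * Poly_Mapping.lookup a s"
  by (simp add: cscale_def Poly_Mapping.map.rep_eq when_def)

lemma pairing_cscale: "pairing (cscale r a) \<omega> = r * pairing a \<omega>"
proof -
  have "Poly_Mapping.keys (cscale r a) \<subseteq> Poly_Mapping.keys a"
    by (auto simp: in_keys_iff)
  then show ?thesis
    by (simp add: pairing_superset[of "Poly_Mapping.keys a"] sum_distrib_left mult.assoc)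
qed

lemma pairing_sum: "finite S \<Longrightarrow> pairing (\<Sum>s\<in>S. f s) \<omega> = (\<Sum>s\<in>S. pairing (f s) \<omega>)"
  by (induction S rule: finite_induct) (simp_all add: pairing_add, simp add: pairing_def)

lemma pairing_cbasis [simp]: "pairing (cbasis s) \<omega> = \<omega> s"
  by (simp add: pairing_def cbasis_def)

lemma bdry_cbasis [simp]: "bdry (cbasis s) = bdry4 s"
  by (rule poly_mapping_eqI) (simp add: bdry_def clinear_ext_def cbasis_def)

lemma pairing_bdry: "pairing (bdry a) \<omega> = pairing a (\<lambda>s. pairing (bdry4 s) \<omega>)"
  by (simp add: bdry_def clinear_ext_def pairing_sum pairing_cscale pairing_def[of a])

lemma dc_apply: "dc \<omega> s = pairing (bdry4 s) \<omega>"
proof -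
  have "dc \<omega> = (\<lambda>s. pairing (bdry4 s) \<omega>)"
    unfolding dc_def
  proof (rule the_equality)
    fix \<eta> assume "\<forall>a. pairing (bdry a) \<omega> = pairing a \<eta>"
    then have "pairing (bdry (cbasis s)) \<omega> = pairing (cbasis s) \<eta>" for s by blast
    then show "\<eta> = (\<lambda>s. pairing (bdry4 s) \<omega>)" by auto
  qed (simp add: pairing_bdry)
  then show ?thesis by simp
qed

lemma dc_adjoint: "pairing (bdry a) \<omega> = pairing a (dc \<omega>)"
  by (simp add: pairing_bdry dc_apply[abs_def])

lemma pairing_diff: "pairing (a - b) \<omega> = pairing a \<omega> - pairing b \<omega>"
  using pairing_add[of "a - b" b \<omega>] by simp

lemma pairing_zero [simp]: "pairing 0 \<omega> = 0"
  by (simp add: pairing_def)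

lemma pairing_ctensor: "pairing (ctensor a b) \<omega> = pairing a (\<lambda>s. pairing b (\<lambda>t. \<omega> (s, t)))"
  by (simp add: ctensor_def clinear_ext_def pairing_sum pairing_cscale pairing_def[of a]
      pairing_def[of b])

lemmas bdry_simps = bdry4_def bdry3_def bdry2_def bdry_tensor_def pairing_add pairing_cscale
  pairing_ctensor pairing_diff
lemmas deg_simps = deg4_def deg3_def deg2_def deg_tensor_def

lemma dc_homogeneous: "\<omega> \<in> homogeneous r \<Longrightarrow> dc \<omega> \<in> homogeneous (Suc r)"
proof -
  assume "\<omega> \<in> homogeneous r"
  then have *: "deg4 t \<noteq> r \<Longrightarrow> \<omega> t = 0" for t unfolding homogeneous_def by blast
  have "dc \<omega> s = 0" if "deg4 s \<noteq> Suc r" for s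
  proof -
    obtain a b c d where s: "s = (((a, b), c), d)" by (metis surj_pair)
    show ?thesis using that unfolding s
      by (cases a; cases b; cases c; cases d)
        (simp_all add: dc_apply bdry_simps, simp_all add: * deg_simps)
  qed
  then show ?thesis unfolding homogeneous_def by blast
qed

lemma deg4_le: "deg4 s \<le> 4"
proof -
  have "deg1 a \<le> 1" for a by (cases a) auto
  then have *: "deg1 a + deg1 b + deg1 c + deg1 d \<le> 1 + 1 + 1 + 1" for a b c d
    by (intro add_mono)
  obtain a b c d where s: "s = (((a, b), c), d)" by (metis surj_pair)
  show ?thesis using *[of a b c d] by (simp add: s deg_simps)
qed

lemma dc_top: "\<omega> \<in> homogeneous 4 \<Longrightarrow> dc \<omega> = 0"
proof
  fix s assume "\<omega> \<in> homogeneous 4"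
  then have "dc \<omega> s \<noteq> 0 \<Longrightarrow> deg4 s = Suc 4"
    using dc_homogeneous[of \<omega> 4] unfolding homogeneous_def by blast
  then show "dc \<omega> s = 0 s" using deg4_le[of s] by fastforce
qed

lemma cup_fbasis: "cup (fbasis s) (fscale r (fbasis t)) = fscale r (cup4 s t)"
proof
  fix u
  have "cup (fbasis s) (fscale r (fbasis t)) u
      = Sum_any (\<lambda>p. if p = (s, t) then r * cup4 s t u else 0)"
    unfolding cup_def
    by (intro arg_cong[where f = Sum_any]) (auto simp: fbasis_def fscale_def fun_eq_iff)
  also have "\<dots> = (\<Sum>p\<in>{(s, t)}. if p = (s, t) then r * cup4 s t u else 0)"
    by (rule Sum_any.expand_superset) auto
  finally show "cup (fbasis s) (fscale r (fbasis t)) u = fscale r (cup4 s t) u"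
    by (simp add: fscale_def)
qed

fun dual1 :: "cell \<Rightarrow> cell" where
  "dual1 (X \<kappa>) = E \<kappa>"
| "dual1 (E \<kappa>) = X (\<tau> \<kappa>)"

definition dual4 :: "cell4 \<Rightarrow> cell4" where
  "dual4 = (\<lambda>(((a, b), c), d). (((dual1 a, dual1 b), dual1 c), dual1 d))"

lemma bij_dual4: "bij dual4"
proof -
  have *: "dual1 a = dual1 b \<longleftrightarrow> a = b" for a b by (cases a; cases b) auto
  have **: "\<exists>a. b = dual1 a" for b
  proof (cases b)
    case (X \<kappa>) then show ?thesis by (intro exI[of _ "E (\<kappa> - 1)"]) simp
  next
    case (E \<kappa>) then show ?thesis by (intro exI[of _ "X \<kappa>"]) simp
  qed
  have "inj dual4" by (rule injI) (auto simp: dual4_def * split: prod.splits)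
  moreover have "y \<in> range dual4" for y
  proof -
    obtain a b c d where y: "y = (((a, b), c), d)" by (metis surj_pair)
    from ** obtain a' b' c' d' where
      "a = dual1 a'" "b = dual1 b'" "c = dual1 c'" "d = dual1 d'" by metis
    then have "y = dual4 (((a', b'), c'), d')" by (simp add: y dual4_def)
    then show ?thesis by blast
  qed
  ultimately show ?thesis by (auto simp: bij_def)
qed

text \<open>Value of \<open>cup1 s t\<close> at \<open>top1 s\<close> is nonzero only for \<open>t = dual1 s\<close>.\<close>

lemma cup1_top1: "cup1 s t (top1 s) = (if t = dual1 s then 1 else 0)"
  by (cases s; cases t) (auto simp: fbasis_def)

lemma cup1_dual1: "cup1 s (dual1 s) = fbasis (top1 s)"
  by (cases s) auto

lemma ftensor_fbasis: "ftensor (fbasis s) (fbasis t) = fbasis (s, t)"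
  by (auto simp: ftensor_def fbasis_def fun_eq_iff)

lemma ftensor_fscale: "ftensor (fscale r \<omega>) \<eta> = fscale r (ftensor \<omega> \<eta>)"
  by (auto simp: ftensor_def fscale_def fun_eq_iff)

lemma fscale_fscale: "fscale r (fscale q \<omega>) = fscale (r * q) \<omega>"
  by (auto simp: fscale_def fun_eq_iff)

lemma Qcup_values: "Qcup s q = 1 \<or> Qcup s q = -1"
  by (auto simp: Qcup_def)

definition sgn_cup :: "cell4 \<Rightarrow> real" where
  "sgn_cup = (\<lambda>(((a, b), c), d).
     Qcup d (deg3 ((dual1 a, dual1 b), dual1 c)) * Qcup c (deg2 (dual1 a, dual1 b))
     * Qcup b (deg1 (dual1 a)))"

lemma cup4_dual4: "cup4 s (dual4 s) = fscale (sgn_cup s) (fbasis (top4 s))"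
  by (auto simp: cup4_def cup3_def cup2_def cup_tensor_def dual4_def top4_def sgn_cup_def
      cup1_dual1 ftensor_fbasis ftensor_fscale fscale_fscale mult.assoc split: prod.splits)

lemma cup4_top4: "cup4 s t (top4 s) = (if t = dual4 s then sgn_cup s else 0)"
  by (auto simp: cup4_def cup3_def cup2_def cup_tensor_def dual4_def top4_def sgn_cup_def
      cup1_top1 ftensor_def fscale_def split: prod.splits)

lemma sgn_cup_values: "sgn_cup s = 1 \<or> sgn_cup s = -1"
proof -
  obtain a b c d where s: "s = (((a, b), c), d)" by (metis surj_pair)
  show ?thesis unfolding s sgn_cup_def prod.case
    using Qcup_values[of d "deg3 ((dual1 a, dual1 b), dual1 c)"]
      Qcup_values[of c "deg2 (dual1 a, dual1 b)"] Qcup_values[of b "deg1 (dual1 a)"] by auto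
qed

lemma Qlorentz_values: "Qlorentz s = 1 \<or> Qlorentz s = -1"
  by (auto simp: Qlorentz_def split: prod.splits cell.splits)

lemma fscale_one [simp]: "fscale 1 \<omega> = \<omega>" and fscale_minus_one: "fscale (-1) \<omega> = - \<omega>"
  by (auto simp: fscale_def fun_eq_iff)

lemma star_basis_unique:
  "(\<exists>t. \<phi> = fbasis t \<or> \<phi> = - fbasis t) \<and>
     cup (fbasis s) \<phi> = fscale (Qlorentz s) (fbasis (top4 s)) \<longleftrightarrow>
   \<phi> = fscale (Qlorentz s * sgn_cup s) (fbasis (dual4 s))" (is "?L \<longleftrightarrow> ?R")
proof
  assume L: ?L
  then obtain t where "\<phi> = fbasis t \<or> \<phi> = - fbasis t" by blast
  then obtain r where \<phi>: "\<phi> = fscale r (fbasis t)" and r: "r = 1 \<or> r = -1"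
    by (metis fscale_one fscale_minus_one)
  have "cup (fbasis s) \<phi> (top4 s) = Qlorentz s"
    using L by (simp add: fscale_def fbasis_def)
  then have *: "r * (if t = dual4 s then sgn_cup s else 0) = Qlorentz s"
    unfolding \<phi> cup_fbasis by (simp only: fscale_def cup4_top4)
  then have "t = dual4 s" using Qlorentz_values[of s] by (auto split: if_splits)
  moreover from this * have "r = Qlorentz s * sgn_cup s" using sgn_cup_values[of s] by auto
  ultimately show ?R by (simp add: \<phi>)
next
  assume R: ?R
  have "Qlorentz s * sgn_cup s = 1 \<or> Qlorentz s * sgn_cup s = -1"
    using Qlorentz_values[of s] sgn_cup_values[of s] by auto
  then have "\<exists>t. \<phi> = fbasis t \<or> \<phi> = - fbasis t"
    using R by (metis fscale_one fscale_minus_one)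
  moreover have "sgn_cup s * sgn_cup s = 1" using sgn_cup_values[of s] by auto
  ultimately show ?L
    by (simp add: R cup_fbasis cup4_dual4 fscale_fscale mult.assoc)
qed

lemma star_basis_eq: "star_basis s = fscale (Qlorentz s * sgn_cup s) (fbasis (dual4 s))"
  unfolding star_basis_def star_basis_unique by simp

lemma star_apply: "star \<omega> (dual4 s) = Qlorentz s * sgn_cup s * \<omega> s"
proof -
  have inj: "dual4 s = dual4 s' \<longleftrightarrow> s = s'" for s'
    using bij_dual4 by (metis bij_pointE)
  have "star \<omega> (dual4 s) = (\<Sum>s'\<in>{s}. \<omega> s' * star_basis s' (dual4 s))"
    unfolding star_def by (rule Sum_any.expand_superset)
      (auto simp: star_basis_eq fscale_def fbasis_def inj)
  then show ?thesis by (simp add: star_basis_eq fscale_def fbasis_def)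
qed

lemma star_homogeneous:
  assumes "\<omega> \<in> homogeneous r" shows "star \<omega> \<in> homogeneous (4 - r)"
proof -
  have *: "deg1 (dual1 a) = 1 - deg1 a" "deg1 a \<le> 1" for a by (cases a; simp)+
  have deg: "deg4 (dual4 s) = 4 - deg4 s" for s
  proof -
    obtain a b c d where s: "s = (((a, b), c), d)" by (metis surj_pair)
    show ?thesis
      using *(2)[of a] *(2)[of b] *(2)[of c] *(2)[of d] by (simp add: s deg_simps dual4_def *(1))
  qed
  have "deg4 t = 4 - r" if "star \<omega> t \<noteq> 0" for t
  proof -
    obtain s where t: "t = dual4 s" using bij_dual4 by (metis bij_pointE)
    have "\<omega> s \<noteq> 0" using that by (auto simp: t star_apply)
    then have "deg4 s = r" using assms unfolding homogeneous_def by blast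
    then show ?thesis by (simp add: t deg)
  qed
  then show ?thesis unfolding homogeneous_def by blast
qed

lemma bij_star: "bij star"
proof (rule o_bij)
  let ?q = "\<lambda>s. Qlorentz s * sgn_cup s"
  have q: "?q s * ?q s = 1" for s using Qlorentz_values[of s] sgn_cup_values[of s] by auto
  define g where "g \<eta> = (\<lambda>s. ?q s * \<eta> (dual4 s))" for \<eta> :: form
  have "g (star \<omega>) s = \<omega> s" for \<omega> s
    using q[of s] unfolding g_def star_apply by (metis mult.assoc mult_1)
  then show "g \<circ> star = id" by (simp add: fun_eq_iff)
  have "star (g \<eta>) t = \<eta> t" for \<eta> t
  proof -
    obtain s where t: "t = dual4 s" using bij_dual4 by (metis bij_pointE)
    show ?thesis using q[of s] unfolding t star_apply g_def by (metis mult.assoc mult_1)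
  qed
  then show "star \<circ> g = id" by (simp add: fun_eq_iff)
qed

end

theory Submission
  imports Defs
begin

text \<open>
  Since \<open>\<Delta>\<^sup>c = -(d\<^sup>c\<delta>\<^sup>c + \<delta>\<^sup>cd\<^sup>c)\<close>, nilpotency of \<open>d\<^sup>c\<close> and \<open>\<delta>\<^sup>c\<close> gives
  \<open>(d\<^sup>c - \<delta>\<^sup>c)(d\<^sup>c - \<delta>\<^sup>c)\<Phi> = \<Delta>\<^sup>c\<Phi>\<close>, so a harmonic \<open>\<Phi>\<close> contributes nothing.  For
  \<open>\<delta>\<^sup>c\<delta>\<^sup>c = 0\<close>, write \<open>\<delta>\<^sup>c = \<ast>\<^sup>-\<^sup>1 d\<^sup>c \<ast> \<epsilon>\<close> with the grade involution \<open>\<epsilon>\<close>, which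
  commutes with \<open>\<ast>\<close> (as \<open>4 - r\<close> and \<open>r\<close> have the same parity) and anticommutes with \<open>d\<^sup>c\<close>.
\<close>

lemma pairing_plus_right: "pairing a (\<omega> + \<eta>) = pairing a \<omega> + pairing a \<eta>"
  by (simp add: pairing_def algebra_simps sum.distrib)

lemma pairing_fscale_right: "pairing a (fscale r \<omega>) = r * pairing a \<omega>"
  by (simp add: pairing_def fscale_def sum_distrib_left mult.left_commute)

lemma dc_add: "dc (\<omega> + \<eta>) = dc \<omega> + dc \<eta>"
  by (rule ext) (simp add: dc_apply pairing_plus_right)

lemma dc_fscale: "dc (fscale r \<omega>) = fscale r (dc \<omega>)"
  by (rule ext) (simp add: dc_apply pairing_fscale_right fscale_def[of r "dc \<omega>"])

text \<open>\<open>star_apply\<close> gives the values of \<open>star\<close> only at points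
  \<open>dual4 s\<close>; these exhaust the basis because \<open>dual4\<close> is bijective.\<close>

lemma form_eqI_dual4:
  assumes "\<And>s. \<omega> (dual4 s) = \<eta> (dual4 s)"
  shows "\<omega> = \<eta>"
proof
  fix t
  obtain s where "t = dual4 s" using bij_dual4 by (metis bij_pointE)
  then show "\<omega> t = \<eta> t" using assms by simp
qed

lemma star_add: "star (\<omega> + \<eta>) = star \<omega> + star \<eta>"
  by (rule form_eqI_dual4) (simp add: star_apply algebra_simps)

lemma star_fscale: "star (fscale r \<omega>) = fscale r (star \<omega>)"
  by (rule form_eqI_dual4) (simp add: star_apply fscale_def)

lemma star_inv_star [simp]: "star (inv star \<omega>) = \<omega>"
  using bij_star by (simp add: bij_def surj_f_inv_f)

lemma inv_star_eqI: "star \<eta> = \<omega> \<Longrightarrow> inv star \<omega> = \<eta>"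
  using bij_star by (metis bij_inv_eq_iff)

lemma inv_star_add: "inv star (\<omega> + \<eta>) = inv star \<omega> + inv star \<eta>"
  by (rule inv_star_eqI) (simp add: star_add)

lemma inv_star_fscale: "inv star (fscale r \<omega>) = fscale r (inv star \<omega>)"
  by (rule inv_star_eqI) (simp add: star_fscale)

lemma inv_star_zero: "inv star 0 = 0"
  by (intro inv_star_eqI form_eqI_dual4) (simp add: star_apply)

text \<open>On a single factor \<open>bdry1\<close> squares to zero; terms that differentiate two
  different factors occur twice, with opposite signs by \<open>bdry_tensor\<close>.\<close>

lemma dc_dc: "dc (dc \<omega>) = 0"
proof
  fix s :: cell4
  obtain a b c d where s: "s = (((a, b), c), d)" by (metis surj_pair)
  have "dc (dc \<omega>) s = pairing (bdry4 s) (\<lambda>t. pairing (bdry4 t) \<omega>)"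
    by (simp add: dc_apply[abs_def])
  also have "\<dots> = 0"
    unfolding s by (cases a; cases b; cases c; cases d) (simp_all add: bdry_simps deg_simps)
  finally show "dc (dc \<omega>) s = 0 s" by simp
qed

definition grade_inv :: "form \<Rightarrow> form" where
  "grade_inv \<omega> = (\<lambda>s. (-1) ^ deg4 s * \<omega> s)"

lemma grade_inv_add: "grade_inv (\<omega> + \<eta>) = grade_inv \<omega> + grade_inv \<eta>"
  by (simp add: grade_inv_def fun_eq_iff algebra_simps)

lemma grade_inv_zero: "grade_inv 0 = 0"
  by (simp add: grade_inv_def fun_eq_iff)

text \<open>The boundary of a basis element lies one degree lower, so weighting by parity before or
  after \<open>dc\<close> differs by a factor -1.\<close>

lemma dc_grade_inv: "dc (grade_inv \<omega>) = - grade_inv (dc \<omega>)"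
proof
  fix s :: cell4
  obtain a b c d where s: "s = (((a, b), c), d)" by (metis surj_pair)
  show "dc (grade_inv \<omega>) s = (- grade_inv (dc \<omega>)) s"
    unfolding s
    by (cases a; cases b; cases c; cases d)
      (simp_all add: grade_inv_def dc_apply bdry_simps deg_simps)
qed

text \<open>Each of the four factors changes parity under \<open>dual1\<close>, and four changes
  cancel.\<close>

lemma even_deg4_dual4: "even (deg4 (dual4 s)) \<longleftrightarrow> even (deg4 s)"
proof -
  have *: "even (deg1 (dual1 a)) \<longleftrightarrow> odd (deg1 a)" for a by (cases a) simp_all
  obtain a b c d where s: "s = (((a, b), c), d)" by (metis surj_pair)
  show ?thesis unfolding s by (auto simp: deg_simps dual4_def *)
qed

lemma star_grade_inv: "star (grade_inv \<omega>) = grade_inv (star \<omega>)"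
  by (rule form_eqI_dual4)
    (simp add: star_apply grade_inv_def minus_one_power_iff even_deg4_dual4)

lemma hpart_in_homogeneous: "hpart r \<omega> \<in> homogeneous r"
  by (simp add: homogeneous_def hpart_def)

text \<open>Degree 0 is split off because the sum defining \<open>codiff\<close> starts at
  1.\<close>

lemma grade_inv_hpart:
  "grade_inv \<omega> = hpart 0 \<omega> + (\<Sum>r = 1..4. fscale ((-1) ^ r) (hpart r \<omega>))"
proof
  fix s
  have "deg4 s \<in> {0, 1, 2, 3, 4}" using deg4_le[of s] by auto
  then show "grade_inv \<omega> s
      = (hpart 0 \<omega> + (\<Sum>r = 1..4. fscale ((-1) ^ r) (hpart r \<omega>))) s"
    by (auto simp: grade_inv_def hpart_def fscale_def eval_nat_numeral)
qed

lemma codiff_eq: "codiff \<omega> = inv star (dc (star (grade_inv \<omega>)))"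
proof -
  \<comment> \<open>\<open>star\<close> sends degree 0 to the top degree, where \<open>dc\<close>
    vanishes, so the term missing from \<open>codiff\<close> may be added.\<close>
  have "dc (star (hpart 0 \<omega>)) = 0"
    using star_homogeneous[OF hpart_in_homogeneous, of 0 \<omega>] by (simp add: dc_top)
  then show ?thesis
    by (simp add: codiff_def grade_inv_hpart star_add dc_add inv_star_add star_fscale dc_fscale
        inv_star_fscale inv_star_zero eval_nat_numeral)
qed

lemma codiff_add: "codiff (\<omega> + \<eta>) = codiff \<omega> + codiff \<eta>"
  by (simp add: codiff_eq grade_inv_add star_add dc_add inv_star_add)

lemma codiff_codiff: "codiff (codiff \<omega>) = 0"
proof -
  \<comment> \<open>The outer \<open>star\<close> moves past \<open>grade_inv\<close> and cancels
    the inner \<open>inv star\<close>.\<close>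
  have "codiff (codiff \<omega>) = inv star (dc (grade_inv (dc (star (grade_inv \<omega>)))))"
    by (simp add: codiff_eq star_grade_inv)
  also have "\<dots> = 0"
    by (simp add: dc_grade_inv dc_dc grade_inv_zero inv_star_zero)
  finally show ?thesis .
qed

lemma dc_diff: "dc (\<omega> - \<eta>) = dc \<omega> - dc \<eta>"
  using dc_add[of "\<omega> - \<eta>" \<eta>] by simp

lemma codiff_diff: "codiff (\<omega> - \<eta>) = codiff \<omega> - codiff \<eta>"
  using codiff_add[of "\<omega> - \<eta>" \<eta>] by simp

theorem proposition6p2:
  fixes \<Phi> \<Omega> :: form
  assumes "laplacian \<Phi> = 0"
  shows "dc \<Omega> - codiff \<Omega> = 0 \<longleftrightarrow>
         dc (\<Omega> + dc \<Phi> - codiff \<Phi>) - codiff (\<Omega> + dc \<Phi> - codiff \<Phi>) = 0"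
proof -
  have "dc (\<Omega> + dc \<Phi> - codiff \<Phi>) - codiff (\<Omega> + dc \<Phi> - codiff \<Phi>)
      = dc \<Omega> - codiff \<Omega> + laplacian \<Phi>"
    by (simp add: dc_add dc_diff codiff_add codiff_diff dc_dc codiff_codiff laplacian_def)
  then show ?thesis using assms by simp
qed

end
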